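(* Let $\mathcal{R}$ be a non-duplicating probabilistic term rewrite system (PTRS), and let $\mathcal{DP}(\mathcal{R})$ be its set of canonical annotated dependency pairs. Then $\mathcal{R}$ is almost-surely terminating ($\mathtt{AST}$) if and only if the ADP problem $\mathcal{DP}(\mathcal{R})$ is $\mathtt{AST}$.
   Context: **Terms.** $\Sigma$ is a finite signature, $\mathcal{V}$ a set of variables, $\mathcal{T}=\mathcal{T}(\Sigma,\mathcal{V})$ the set of terms. $\mathcal{V}(t)$ is the set of variables of $t$; $\mathrm{Pos}(t)$ the set of positions of $t$ (root position $\varepsilon$); $t|_\pi$ the subterm at $\pi$; $t[r]_\pi$ the replacement of that subterm by $r$. A substitution is $\sigma:\mathcal{V}\to\mathcal{T}$ with $\sigma(x)=x$ for all but finitely many $x$. **PTRSs.** A finite multi-distribution on a set $M$ is a finite multiset of pairs $(p:a)$ with $0<p\le 1$, $a\in M$, whose probabilities sum to $1$; $\mathrm{Supp}(\mu)$ is the multiset of the $a$'s occurring in $\mu$. A probabilistic rule $\ell\to\mu$ consists of a term $\ell\in\mathcal{T}\setminus\mathcal{V}$ and a finite multi-distribution $\mu$ on $\mathcal{T}$ with $\mathcal{V}(r)\subseteq\mathcal{V}(\ell)$ for all $r\in\mathrm{Supp}(\mu)$. A PTRS $\mathcal{R}$ is a finite set of such rules. It is non-duplicating if for every $\ell\to\mu\in\mathcal{R}$ and $r\in\mathrm{Supp}(\mu)$, every variable occurs at most as often in $r$ as in $\ell$. We have $s\to_{\mathcal{R}}\{p_1:t_1,\dots,p_k:t_k\}$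 if there are $\ell\to\{p_1:r_1,\dots,p_k:r_k\}\in\mathcal{R}$, a substitution $\sigma$ and $\pi\in\mathrm{Pos}(s)$ with $s|_\pi=\ell\sigma$ and $t_j=s[r_j\sigma]_\pi$ for all $j$. **AST of a PTRS.** An $\mathcal{R}$-rewrite sequence tree (RST) is a (possibly infinite) finitely branching tree whose nodes $v$ are labeled by pairs $(p_v:t_v)$ of a probability and a term, the root having probability $1$, such that for each node $v$ with successors $w_1,\dots,w_k$ ($k\ge1$), $t_v\to_{\mathcal{R}}\{\frac{p_{w_1}}{p_v}:t_{w_1},\dots,\frac{p_{w_k}}{p_v}:t_{w_k}\}$. For such a tree $\mathfrak{T}$, $|\mathfrak{T}|_{\mathrm{Leaf}}$ is the sum of $p_v$ over all leaves $v$. $\mathcal{R}$ is $\mathtt{AST}$ if $|\mathfrak{T}|_{\mathrm{Leaf}}=1$ for all $\mathcal{R}$-RSTs $\mathfrak{T}$. **Annotations.** $\mathcal{D}\subseteq\Sigma$ is the set of defined symbols, i.e., root symbols of left-hand sides of rules of $\mathcal{R}$. For each $f\in\mathcal{D}$ let $f^\#$ be a fresh symbol of the same arity; $\mathcal{D}^\#=\{f^\#\mid f\in\mathcal{D}\}$, $\Sigma^\#=\Sigma\uplus\mathcal{D}^\#$, $\mathcal{T}^\#=\mathcal{T}(\Sigma^\#,\mathcal{V})$. $\mathrm{Pos}_X(t)$ is the set of positions of $t$ carrying a symbol or variable from $X$. For $\Phi\subseteq\mathrm{Pos}_{\mathcal{D}\cup\mathcal{D}^\#}(t)$, $\#_\Phi(t)$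 is the variant of $t$ where exactly the symbols at positions in $\Phi$ are annotated (all other annotations are removed); $\flat(t)=\#_\emptyset(t)$. $\flat^\uparrow_\pi(t)$ results from $t$ by removing all annotations strictly above position $\pi$. **ADPs.** An annotated dependency pair (ADP) has the form $\ell\to\{p_1:r_1,\dots,p_k:r_k\}^m$ with $\ell\in\mathcal{T}\setminus\mathcal{V}$, $m\in\{\mathsf{true},\mathsf{false}\}$, $r_j\in\mathcal{T}^\#$, $\mathcal{V}(r_j)\subseteq\mathcal{V}(\ell)$, probabilities $p_j\in(0,1]$ summing to $1$. An ADP problem is a finite set of ADPs. The canonical ADP of a rule $\ell\to\{p_1:r_1,\dots,p_k:r_k\}$ is $\ell\to\{p_1:\#_{\mathrm{Pos}_{\mathcal{D}}(r_1)}(r_1),\dots,p_k:\#_{\mathrm{Pos}_{\mathcal{D}}(r_k)}(r_k)\}^{\mathsf{true}}$; $\mathcal{DP}(\mathcal{R})$ is the set of canonical ADPs of all rules of $\mathcal{R}$. **Rewriting with ADPs.** A variable reposition function (VRF) for an ADP $\ell\to\{p_1:r_1,\dots,p_k:r_k\}^m$ is a family of functions $\varphi_j:\mathrm{Pos}_{\mathcal{V}}(\ell)\to\mathrm{Pos}_{\mathcal{V}}(r_j)\uplus\{\bot\}$, $1\le j\le k$, with $\ell|_\rho=r_j|_{\varphi_j(\rho)}$ whenever $\varphi_j(\rho)\ne\bot$. For an ADP problem $\mathcal{P}$, a term $s\in\mathcal{T}^\#$ rewrites with $\mathcal{P}$ to $\{p_1:t_1,\dots,p_k:t_k\}$ (written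 $s\hookrightarrow_{\mathcal{P}}\{p_1:t_1,\dots,p_k:t_k\}$) if there are an ADP $\ell\to\{p_1:r_1,\dots,p_k:r_k\}^m\in\mathcal{P}$, a VRF $(\varphi_j)_j$ for it, a substitution $\sigma$ and $\pi\in\mathrm{Pos}_{\mathcal{D}\cup\mathcal{D}^\#}(s)$ with $\flat(s|_\pi)=\ell\sigma$, such that for all $j$: - (at) $t_j=s[\#_{\Phi_j}(r_j\sigma)]_\pi$ if $\pi\in\mathrm{Pos}_{\mathcal{D}^\#}(s)$ and $m=\mathsf{true}$; - (af) $t_j=\flat^\uparrow_\pi(s[\#_{\Phi_j}(r_j\sigma)]_\pi)$ if $\pi\in\mathrm{Pos}_{\mathcal{D}^\#}(s)$ and $m=\mathsf{false}$; - (nt) $t_j=s[\#_{\Psi_j}(r_j\sigma)]_\pi$ if $\pi\notin\mathrm{Pos}_{\mathcal{D}^\#}(s)$ and $m=\mathsf{true}$. (There is no step if $\pi\notin\mathrm{Pos}_{\mathcal{D}^\#}(s)$ and $m=\mathsf{false}$.) Here $\Psi_j=\{\varphi_j(\rho).\tau\mid\rho\in\mathrm{Pos}_{\mathcal{V}}(\ell),\ \varphi_j(\rho)\ne\bot,\ \rho.\tau\in\mathrm{Pos}_{\mathcal{D}^\#}(s|_\pi)\}$ and $\Phi_j=\mathrm{Pos}_{\mathcal{D}^\#}(r_j)\cup\Psi_j$. **Chain trees and AST of an ADP problem.** A $\mathcal{P}$-chain tree (CT) is $\mathfrak{T}=(V,E,L,A)$ where $(V,E)$ is a non-empty, possibly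 infinite, finitely branching directed tree; $L$ labels each node $v$ by a probability $p_v\in(0,1]$ and a term $t_v\in\mathcal{T}^\#$, with $p_v=1$ for the root; $A$ is a subset of the inner nodes; for each inner node $v$ with successors $w_1,\dots,w_k$, $t_v\hookrightarrow_{\mathcal{P}}\{\frac{p_{w_1}}{p_v}:t_{w_1},\dots,\frac{p_{w_k}}{p_v}:t_{w_k}\}$ using case (at) or (af) if $v\in A$ and another case if $v\notin A$; and every infinite path contains infinitely many nodes from $A$. $|\mathfrak{T}|_{\mathrm{Leaf}}$ is the sum of $p_v$ over all leaves $v$. $\mathcal{P}$ is $\mathtt{AST}$ if $|\mathfrak{T}|_{\mathrm{Leaf}}=1$ for all $\mathcal{P}$-CTs $\mathfrak{T}$. *)

theory Defs
  imports
    "HOL-Library.Multiset"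
    "HOL-Library.Sublist"
    "HOL-Analysis.Infinite_Sum"
begin

section \<open>Terms, positions and substitutions\<close>

datatype (funs: 'f, vars: 'v) trm = Var 'v | Fun 'f "('f, 'v) trm list"

text \<open>A signature is a set of symbols together with an arity function. The set of variables is
  the whole type \<^typ>\<open>'v\<close>.\<close>

inductive_set terms :: "('f \<Rightarrow> nat) \<Rightarrow> 'f set \<Rightarrow> ('f, 'v) trm set"
  for ar :: "'f \<Rightarrow> nat" and \<Sigma> :: "'f set"
  where
    "Var x \<in> terms ar \<Sigma>"
  | "f \<in> \<Sigma> \<Longrightarrow> length ts = ar f \<Longrightarrow> (\<And>t. t \<in> set ts \<Longrightarrow> t \<in> terms ar \<Sigma>) \<Longrightarrow> Fun f ts \<in> terms ar \<Sigma>"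

type_synonym pos = "nat list"

lemma size_nth_trm [termination_simp]:
  fixes ts :: "('f, 'v) trm list"
  shows "i < length ts \<Longrightarrow> size (ts ! i) < Suc (size_list size ts)"
  by (simp add: less_Suc_eq_le size_list_estimation'[OF nth_mem])

declare conj_cong [fundef_cong]

fun poss :: "('f, 'v) trm \<Rightarrow> pos set" where
  "poss (Var x) = {[]}"
| "poss (Fun f ts) = insert [] {i # \<pi> | i \<pi>. i < length ts \<and> \<pi> \<in> poss (ts ! i)}"

text \<open>Subterms and replacement are only meaningful at positions of the term; elsewhere the values
  are unspecified.\<close>

fun subt_at :: "('f, 'v) trm \<Rightarrow> pos \<Rightarrow> ('f, 'v) trm" where
  "subt_at t [] = t"
| "subt_at (Fun f ts) (i # \<pi>) = subt_at (ts ! i) \<pi>"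

fun replace_at :: "('f, 'v) trm \<Rightarrow> pos \<Rightarrow> ('f, 'v) trm \<Rightarrow> ('f, 'v) trm" where
  "replace_at t [] r = r"
| "replace_at (Fun f ts) (i # \<pi>) r = Fun f (ts[i := replace_at (ts ! i) \<pi> r])"

definition fun_poss :: "'f set \<Rightarrow> ('f, 'v) trm \<Rightarrow> pos set" where
  "fun_poss X t = {\<pi> \<in> poss t. \<exists>f ts. f \<in> X \<and> subt_at t \<pi> = Fun f ts}"

definition var_poss :: "('f, 'v) trm \<Rightarrow> pos set" where
  "var_poss t = {\<pi> \<in> poss t. \<exists>x. subt_at t \<pi> = Var x}"

definition occurrences :: "'v \<Rightarrow> ('f, 'v) trm \<Rightarrow> nat" where
  "occurrences x t = card {\<pi> \<in> poss t. subt_at t \<pi> = Var x}"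

primrec subst :: "('v \<Rightarrow> ('f, 'v) trm) \<Rightarrow> ('f, 'v) trm \<Rightarrow> ('f, 'v) trm" where
  "subst \<sigma> (Var x) = \<sigma> x"
| "subst \<sigma> (Fun f ts) = Fun f (map (subst \<sigma>) ts)"

definition is_substitution :: "('f \<Rightarrow> nat) \<Rightarrow> 'f set \<Rightarrow> ('v \<Rightarrow> ('f, 'v) trm) \<Rightarrow> bool" where
  "is_substitution ar \<Sigma> \<sigma> \<longleftrightarrow> (\<forall>x. \<sigma> x \<in> terms ar \<Sigma>) \<and> finite {x. \<sigma> x \<noteq> Var x}"

section \<open>Probabilistic term rewrite systems\<close>

definition multi_distribution :: "'a set \<Rightarrow> (real \<times> 'a) multiset \<Rightarrow> bool" where
  "multi_distribution M \<mu> \<longleftrightarrow>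
     (\<forall>(p, a) \<in># \<mu>. 0 < p \<and> p \<le> 1 \<and> a \<in> M) \<and> (\<Sum>(p, a) \<in># \<mu>. p) = 1"

definition supp :: "(real \<times> 'a) multiset \<Rightarrow> 'a multiset" where
  "supp \<mu> = image_mset snd \<mu>"

type_synonym ('f, 'v) prule = "('f, 'v) trm \<times> (real \<times> ('f, 'v) trm) multiset"

definition is_ptrs :: "('f \<Rightarrow> nat) \<Rightarrow> 'f set \<Rightarrow> ('f, 'v) prule set \<Rightarrow> bool" where
  "is_ptrs ar \<Sigma> R \<longleftrightarrow> finite R \<and>
     (\<forall>(l, \<mu>) \<in> R. l \<in> terms ar \<Sigma> - range Var \<and> multi_distribution (terms ar \<Sigma>) \<mu> \<and>
       (\<forall>r \<in># supp \<mu>. vars r \<subseteq> vars l))"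

definition non_duplicating :: "('f, 'v) prule set \<Rightarrow> bool" where
  "non_duplicating R \<longleftrightarrow>
     (\<forall>(l, \<mu>) \<in> R. \<forall>r \<in># supp \<mu>. \<forall>x. occurrences x r \<le> occurrences x l)"

definition prewrite ::
  "('f \<Rightarrow> nat) \<Rightarrow> 'f set \<Rightarrow> ('f, 'v) prule set \<Rightarrow>
   ('f, 'v) trm \<Rightarrow> (real \<times> ('f, 'v) trm) multiset \<Rightarrow> bool"
  where
  "prewrite ar \<Sigma> R s \<nu> \<longleftrightarrow>
     (\<exists>l \<mu> \<sigma> \<pi>. (l, \<mu>) \<in> R \<and> is_substitution ar \<Sigma> \<sigma> \<and> \<pi> \<in> poss s \<and>
        subt_at s \<pi> = subst \<sigma> l \<and>
        \<nu> = {# (p, replace_at s \<pi> (subst \<sigma> r)). (p, r) \<in># \<mu> #})"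

section \<open>Probabilistically labelled trees\<close>

definition directed_tree :: "'n set \<Rightarrow> ('n \<times> 'n) set \<Rightarrow> 'n \<Rightarrow> bool" where
  "directed_tree V E v\<^sub>0 \<longleftrightarrow>
     v\<^sub>0 \<in> V \<and> E \<subseteq> V \<times> V \<and>
     (\<forall>v \<in> V. (v\<^sub>0, v) \<in> E\<^sup>*) \<and>
     (\<forall>v. (v, v\<^sub>0) \<notin> E) \<and>
     (\<forall>u u' v. (u, v) \<in> E \<and> (u', v) \<in> E \<longrightarrow> u = u')"

definition inner_nodes :: "'n set \<Rightarrow> ('n \<times> 'n) set \<Rightarrow> 'n set" where
  "inner_nodes V E = {v \<in> V. E `` {v} \<noteq> {}}"

definition leaves :: "'n set \<Rightarrow> ('n \<times> 'n) set \<Rightarrow> 'n set" where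
  "leaves V E = {v \<in> V. E `` {v} = {}}"

definition leaf_weight :: "'n set \<Rightarrow> ('n \<times> 'n) set \<Rightarrow> ('n \<Rightarrow> real) \<Rightarrow> real" where
  "leaf_weight V E p = (\<Sum>\<^sub>\<infinity>v \<in> leaves V E. p v)"

definition prob_tree ::
  "'a set \<Rightarrow> 'n set \<Rightarrow> ('n \<times> 'n) set \<Rightarrow> ('n \<Rightarrow> real) \<Rightarrow> ('n \<Rightarrow> 'a) \<Rightarrow> bool"
  where
  "prob_tree T V E p t \<longleftrightarrow>
     (\<exists>v\<^sub>0. directed_tree V E v\<^sub>0 \<and> p v\<^sub>0 = 1) \<and>
     (\<forall>v \<in> V. finite (E `` {v}) \<and> 0 < p v \<and> p v \<le> 1 \<and> t v \<in> T)"

definition successors ::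
  "('n \<times> 'n) set \<Rightarrow> ('n \<Rightarrow> real) \<Rightarrow> ('n \<Rightarrow> 'a) \<Rightarrow> 'n \<Rightarrow> (real \<times> 'a) multiset"
  where
  "successors E p t v = {# (p w / p v, t w). w \<in># mset_set (E `` {v}) #}"

section \<open>Almost-sure termination of a PTRS\<close>

definition is_rst ::
  "('f \<Rightarrow> nat) \<Rightarrow> 'f set \<Rightarrow> ('f, 'v) prule set \<Rightarrow>
   'n set \<Rightarrow> ('n \<times> 'n) set \<Rightarrow> ('n \<Rightarrow> real) \<Rightarrow> ('n \<Rightarrow> ('f, 'v) trm) \<Rightarrow> bool"
  where
  "is_rst ar \<Sigma> R V E p t \<longleftrightarrow>
     prob_tree (terms ar \<Sigma>) V E p t \<and>
     (\<forall>v \<in> inner_nodes V E. prewrite ar \<Sigma> R (t v) (successors E p t v))"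

text \<open>Finitely branching trees have countably many nodes, so up to isomorphism it suffices to
  consider trees whose nodes are natural numbers. The leaf weight always converges, since
  the probabilities of the leaves sum up to at most 1.\<close>

definition ptrs_AST :: "('f \<Rightarrow> nat) \<Rightarrow> 'f set \<Rightarrow> ('f, 'v) prule set \<Rightarrow> bool" where
  "ptrs_AST ar \<Sigma> R \<longleftrightarrow>
     (\<forall>(V :: nat set) E p t. is_rst ar \<Sigma> R V E p t \<longrightarrow> leaf_weight V E p = 1)"

section \<open>Annotated terms\<close>

text \<open>The symbol \<open>Sharp f\<close> is the fresh annotated copy of \<open>f\<close>. Unannotated terms are embedded into
  the annotated ones by \<open>plain\<close>.\<close>

datatype 'f asym = Plain 'f | Sharp 'f

primrec base :: "'f asym \<Rightarrow> 'f" where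
  "base (Plain f) = f"
| "base (Sharp f) = f"

type_synonym ('f, 'v) atrm = "('f asym, 'v) trm"

definition plain :: "('f, 'v) trm \<Rightarrow> ('f, 'v) atrm" where
  "plain = map_trm Plain id"

definition aterms :: "('f \<Rightarrow> nat) \<Rightarrow> 'f set \<Rightarrow> 'f set \<Rightarrow> ('f, 'v) atrm set" where
  "aterms ar \<Sigma> D = terms (ar \<circ> base) (Plain ` \<Sigma> \<union> Sharp ` D)"

definition defined_symbols :: "('f, 'v) prule set \<Rightarrow> 'f set" where
  "defined_symbols R = {f. \<exists>ts \<mu>. (Fun f ts, \<mu>) \<in> R}"

text \<open>Annotate exactly the symbols at the positions in \<open>\<Phi>\<close>, removing all other annotations.\<close>

fun annotate :: "pos set \<Rightarrow> ('f, 'v) atrm \<Rightarrow> ('f, 'v) atrm" where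
  "annotate \<Phi> (Var x) = Var x"
| "annotate \<Phi> (Fun f ts) =
     Fun (if [] \<in> \<Phi> then Sharp (base f) else Plain (base f))
       (map (\<lambda>i. annotate {\<pi>. i # \<pi> \<in> \<Phi>} (ts ! i)) [0..<length ts])"

definition flat :: "('f, 'v) atrm \<Rightarrow> ('f, 'v) atrm" where
  "flat t = annotate {} t"

definition flat_above :: "pos \<Rightarrow> ('f, 'v) atrm \<Rightarrow> ('f, 'v) atrm" where
  "flat_above \<pi> t = annotate {\<tau> \<in> fun_poss (range Sharp) t. \<not> strict_prefix \<tau> \<pi>} t"

section \<open>Annotated dependency pairs\<close>

type_synonym ('f, 'v) adp = "('f, 'v) trm \<times> (real \<times> ('f, 'v) atrm) multiset \<times> bool"

definition is_adp_problem ::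
  "('f \<Rightarrow> nat) \<Rightarrow> 'f set \<Rightarrow> 'f set \<Rightarrow> ('f, 'v) adp set \<Rightarrow> bool"
  where
  "is_adp_problem ar \<Sigma> D P \<longleftrightarrow> finite P \<and>
     (\<forall>(l, \<mu>, m) \<in> P. l \<in> terms ar \<Sigma> - range Var \<and> multi_distribution (aterms ar \<Sigma> D) \<mu> \<and>
       (\<forall>r \<in># supp \<mu>. vars r \<subseteq> vars l))"

definition canonical_adp :: "'f set \<Rightarrow> ('f, 'v) prule \<Rightarrow> ('f, 'v) adp" where
  "canonical_adp D = (\<lambda>(l, \<mu>). (l, {# (p, annotate (fun_poss D r) (plain r)). (p, r) \<in># \<mu> #}, True))"

definition DP :: "('f, 'v) prule set \<Rightarrow> ('f, 'v) adp set" where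
  "DP R = canonical_adp (defined_symbols R) ` R"

lemma vars_annotate: "vars (annotate \<Phi> t) = vars t"
proof (induction \<Phi> t rule: annotate.induct)
  case (2 \<Phi> f ts)
  have "vars (annotate \<Phi> (Fun f ts)) =
      (\<Union>i<length ts. vars (annotate {\<pi>. i # \<pi> \<in> \<Phi>} (ts ! i)))"
    by auto
  also have "\<dots> = (\<Union>i<length ts. vars (ts ! i))"
    using 2 by auto
  also have "\<dots> = vars (Fun f ts)"
    by (auto simp: set_conv_nth)
  finally show ?case .
qed simp

lemma annotate_canonical_in_aterms:
  assumes "t \<in> terms ar \<Sigma>" and "\<Phi> \<subseteq> fun_poss D t"
  shows "annotate \<Phi> (plain t) \<in> aterms ar \<Sigma> D"
  using assms
proof (induction arbitrary: \<Phi> rule: terms.induct)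
  case (1 x)
  then show ?case by (auto simp: plain_def aterms_def intro: terms.intros)
next
  case (2 f ts)
  have "annotate {\<pi>. i # \<pi> \<in> \<Phi>} (plain (ts ! i)) \<in> aterms ar \<Sigma> D" if "i < length ts" for i
    using 2(5) that by (intro 2(4)) (auto simp: fun_poss_def)
  moreover have "f \<in> D" if "[] \<in> \<Phi>"
    using 2(5) that by (auto simp: fun_poss_def)
  ultimately show ?case
    using 2(1,2) by (auto simp: plain_def aterms_def intro!: terms.intros)
qed

lemma is_adp_problem_DP:
  assumes "is_ptrs ar \<Sigma> R"
  shows "is_adp_problem ar \<Sigma> (defined_symbols R) (DP R)"
proof -
  let ?D = "defined_symbols R"
  have "l \<in> terms ar \<Sigma> - range Var \<and> multi_distribution (aterms ar \<Sigma> ?D) \<nu> \<and>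
      (\<forall>r \<in># supp \<nu>. vars r \<subseteq> vars l)"
    if "(l, \<nu>, m) \<in> DP R" for l \<nu> m
  proof -
    from that obtain \<mu> where "(l, \<mu>) \<in> R"
      and \<nu>: "\<nu> = {# (p, annotate (fun_poss ?D r) (plain r)). (p, r) \<in># \<mu> #}"
      by (auto simp: DP_def canonical_adp_def)
    then have l: "l \<in> terms ar \<Sigma> - range Var"
      and \<mu>: "multi_distribution (terms ar \<Sigma>) \<mu>" "\<And>r. r \<in># supp \<mu> \<Longrightarrow> vars r \<subseteq> vars l"
      using assms by (fastforce simp: is_ptrs_def)+
    have "multi_distribution (aterms ar \<Sigma> ?D) \<nu>"
      using \<mu>(1) unfolding \<nu> multi_distribution_def
      by (auto simp: multiset.map_comp comp_def case_prod_unfold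
          intro!: annotate_canonical_in_aterms)
    moreover have "vars r \<subseteq> vars l" if "r \<in># supp \<nu>" for r
      using that \<mu>(2) unfolding \<nu> supp_def
      by (fastforce simp: vars_annotate plain_def trm.set_map)
    ultimately show ?thesis
      using l by blast
  qed
  moreover have "finite (DP R)"
    using assms by (simp add: is_ptrs_def DP_def)
  ultimately show ?thesis
    unfolding is_adp_problem_def by blast
qed

text \<open>The right-hand sides are enumerated as a list, because a VRF may treat equal pairs of the
  multi-distribution differently. The undefined value \<open>\<bottom>\<close> is \<^term>\<open>None\<close>.\<close>

definition is_vrf ::
  "('f, 'v) trm \<Rightarrow> (real \<times> ('f, 'v) atrm) list \<Rightarrow> (nat \<Rightarrow> pos \<Rightarrow> pos option) \<Rightarrow> bool"
  where
  "is_vrf l prs \<phi> \<longleftrightarrow>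
     (\<forall>j < length prs. \<forall>\<rho> \<in> var_poss l. \<forall>\<rho>'. \<phi> j \<rho> = Some \<rho>' \<longrightarrow>
        \<rho>' \<in> var_poss (snd (prs ! j)) \<and> plain (subt_at l \<rho>) = subt_at (snd (prs ! j)) \<rho>')"

text \<open>Here \<open>u\<close> is the (annotated) redex.\<close>

definition moved_annotations ::
  "'f set \<Rightarrow> ('f, 'v) trm \<Rightarrow> (pos \<Rightarrow> pos option) \<Rightarrow> ('f, 'v) atrm \<Rightarrow> pos set"
  where
  "moved_annotations D l \<phi>\<^sub>j u =
     {\<rho>' @ \<tau> | \<rho> \<rho>' \<tau>. \<rho> \<in> var_poss l \<and> \<phi>\<^sub>j \<rho> = Some \<rho>' \<and> \<rho> @ \<tau> \<in> fun_poss (Sharp ` D) u}"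

datatype step_case = AT | AF | NT

inductive adp_step ::
  "('f \<Rightarrow> nat) \<Rightarrow> 'f set \<Rightarrow> 'f set \<Rightarrow> ('f, 'v) adp set \<Rightarrow> step_case \<Rightarrow>
   ('f, 'v) atrm \<Rightarrow> (real \<times> ('f, 'v) atrm) multiset \<Rightarrow> bool"
  for ar :: "'f \<Rightarrow> nat" and \<Sigma> D :: "'f set" and P :: "('f, 'v) adp set"
  where
    AT:
    "\<lbrakk>(l, mset prs, True) \<in> P; is_vrf l prs \<phi>; is_substitution ar \<Sigma> \<sigma>;
      \<pi> \<in> fun_poss (Plain ` D \<union> Sharp ` D) s; flat (subt_at s \<pi>) = plain (subst \<sigma> l);
      \<pi> \<in> fun_poss (Sharp ` D) s;
      \<And>j. \<Psi> j = moved_annotations D l (\<phi> j) (subt_at s \<pi>);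
      \<And>j. \<Phi> j = fun_poss (Sharp ` D) (snd (prs ! j)) \<union> \<Psi> j;
      \<And>j. t j = replace_at s \<pi> (annotate (\<Phi> j) (subst (plain \<circ> \<sigma>) (snd (prs ! j))))\<rbrakk>
     \<Longrightarrow> adp_step ar \<Sigma> D P AT s (mset (map (\<lambda>j. (fst (prs ! j), t j)) [0..<length prs]))"
  | AF:
    "\<lbrakk>(l, mset prs, False) \<in> P; is_vrf l prs \<phi>; is_substitution ar \<Sigma> \<sigma>;
      \<pi> \<in> fun_poss (Plain ` D \<union> Sharp ` D) s; flat (subt_at s \<pi>) = plain (subst \<sigma> l);
      \<pi> \<in> fun_poss (Sharp ` D) s;
      \<And>j. \<Psi> j = moved_annotations D l (\<phi> j) (subt_at s \<pi>);
      \<And>j. \<Phi> j = fun_poss (Sharp ` D) (snd (prs ! j)) \<union> \<Psi> j;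
      \<And>j. t j = flat_above \<pi>
              (replace_at s \<pi> (annotate (\<Phi> j) (subst (plain \<circ> \<sigma>) (snd (prs ! j)))))\<rbrakk>
     \<Longrightarrow> adp_step ar \<Sigma> D P AF s (mset (map (\<lambda>j. (fst (prs ! j), t j)) [0..<length prs]))"
  | NT:
    "\<lbrakk>(l, mset prs, True) \<in> P; is_vrf l prs \<phi>; is_substitution ar \<Sigma> \<sigma>;
      \<pi> \<in> fun_poss (Plain ` D \<union> Sharp ` D) s; flat (subt_at s \<pi>) = plain (subst \<sigma> l);
      \<pi> \<notin> fun_poss (Sharp ` D) s;
      \<And>j. \<Psi> j = moved_annotations D l (\<phi> j) (subt_at s \<pi>);
      \<And>j. t j = replace_at s \<pi> (annotate (\<Psi> j) (subst (plain \<circ> \<sigma>) (snd (prs ! j))))\<rbrakk>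
     \<Longrightarrow> adp_step ar \<Sigma> D P NT s (mset (map (\<lambda>j. (fst (prs ! j), t j)) [0..<length prs]))"

section \<open>Almost-sure termination of an ADP problem\<close>

definition is_chain_tree ::
  "('f \<Rightarrow> nat) \<Rightarrow> 'f set \<Rightarrow> 'f set \<Rightarrow> ('f, 'v) adp set \<Rightarrow>
   'n set \<Rightarrow> ('n \<times> 'n) set \<Rightarrow> ('n \<Rightarrow> real) \<Rightarrow> ('n \<Rightarrow> ('f, 'v) atrm) \<Rightarrow> 'n set \<Rightarrow> bool"
  where
  "is_chain_tree ar \<Sigma> D P V E p t A \<longleftrightarrow>
     prob_tree (aterms ar \<Sigma> D) V E p t \<and>
     A \<subseteq> inner_nodes V E \<and>
     (\<forall>v \<in> inner_nodes V E. \<exists>c. c \<in> (if v \<in> A then {AT, AF} else {NT}) \<and>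
        adp_step ar \<Sigma> D P c (t v) (successors E p t v)) \<and>
     (\<forall>path. (\<forall>i :: nat. (path i, path (Suc i)) \<in> E) \<longrightarrow> infinite (range path \<inter> A))"

definition adp_AST :: "('f \<Rightarrow> nat) \<Rightarrow> 'f set \<Rightarrow> 'f set \<Rightarrow> ('f, 'v) adp set \<Rightarrow> bool" where
  "adp_AST ar \<Sigma> D P \<longleftrightarrow>
     (\<forall>(V :: nat set) E p t A. is_chain_tree ar \<Sigma> D P V E p t A \<longrightarrow> leaf_weight V E p = 1)"

end

theory Submission
  imports Defs
begin

text \<open>Both directions keep the tree and its probabilities and only change the labelling terms.
  Removing all annotations turns a chain tree into a rewrite sequence tree. Conversely, annotate all
  defined symbols of a rewrite sequence tree: since rules are non-duplicating, there is a VRF that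
  reaches every variable position of the right-hand side, so this labelling is preserved by
  rewriting with canonical ADPs. Hence every redex is annotated, every step is of kind (at), and
  the condition on infinite paths holds with all inner nodes in \<open>A\<close>.\<close>

section \<open>Positions\<close>

lemma finite_poss [simp]: "finite (poss t)"
proof (induction t)
  case (Fun f ts)
  have "{i # \<pi> | i \<pi>. i < length ts \<and> \<pi> \<in> poss (ts ! i)}
      = (\<Union>i<length ts. (#) i ` poss (ts ! i))"
    by auto
  with Fun show ?case by simp
qed simp

lemma Nil_in_poss [simp]: "[] \<in> poss t"
  by (cases t) auto

lemma poss_map_trm [simp]: "poss (map_trm f g t) = poss t"
proof (induction t)
  case (Fun h ts)
  then show ?case by (auto simp: nth_map)
qed simp

lemma subt_at_map_trm:
  "\<pi> \<in> poss t \<Longrightarrow> subt_at (map_trm f g t) \<pi> = map_trm f g (subt_at t \<pi>)"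
  by (induction t \<pi> rule: subt_at.induct) auto

lemma replace_at_map_trm:
  "\<pi> \<in> poss t \<Longrightarrow> map_trm f g (replace_at t \<pi> r) = replace_at (map_trm f g t) \<pi> (map_trm f g r)"
  by (induction t \<pi> r rule: replace_at.induct) (auto simp: map_update)

lemma map_trm_subst:
  "map_trm f id (subst \<sigma> t) = subst (map_trm f id \<circ> \<sigma>) (map_trm f id t)"
  by (induction t) auto

text \<open>Variable positions of \<open>t\<close> are sent to the second alternative, so in the
  first one the symbol at \<open>\<pi>\<close> stems from \<open>t\<close> itself and not from
  \<open>\<sigma>\<close>.\<close>

lemma poss_subst_cases:
  assumes "\<pi> \<in> poss (subst \<sigma> t)"
  shows "\<pi> \<in> poss t - var_poss t \<or> (\<exists>\<rho> \<in> var_poss t. prefix \<rho> \<pi>)"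
  using assms
proof (induction t arbitrary: \<pi>)
  case (Var x)
  then show ?case by (simp add: var_poss_def)
next
  case (Fun f ts)
  show ?case
  proof (cases \<pi>)
    case Nil
    then show ?thesis by (simp add: var_poss_def)
  next
    case (Cons i \<pi>')
    then have i: "i < length ts" and "\<pi>' \<in> poss (subst \<sigma> (ts ! i))"
      using Fun.prems by auto
    then have IH: "\<pi>' \<in> poss (ts ! i) - var_poss (ts ! i) \<or>
        (\<exists>\<rho> \<in> var_poss (ts ! i). prefix \<rho> \<pi>')"
      using Fun.IH[OF nth_mem[OF i]] by blast
    have "i # \<rho> \<in> var_poss (Fun f ts) \<longleftrightarrow> \<rho> \<in> var_poss (ts ! i)" for \<rho>
      using i by (simp add: var_poss_def)
    moreover have "i # \<rho> \<in> poss (Fun f ts) \<longleftrightarrow> \<rho> \<in> poss (ts ! i)" for \<rho>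
      using i by simp
    ultimately show ?thesis
      using IH Cons by (metis Cons_prefix_Cons DiffD1 DiffD2 DiffI)
  qed
qed

lemma poss_substI: "\<pi> \<in> poss t \<Longrightarrow> \<pi> \<in> poss (subst \<sigma> t)"
  by (induction t \<pi> rule: subt_at.induct) auto

lemma subt_at_subst:
  "\<pi> \<in> poss t \<Longrightarrow> subt_at (subst \<sigma> t) \<pi> = subst \<sigma> (subt_at t \<pi>)"
  by (induction t \<pi> rule: subt_at.induct) auto

lemma poss_append: "\<rho> @ \<tau> \<in> poss t \<longleftrightarrow> \<rho> \<in> poss t \<and> \<tau> \<in> poss (subt_at t \<rho>)"
  by (induction t \<rho> rule: subt_at.induct) auto

lemma subt_at_append:
  "\<pi> \<in> poss t \<Longrightarrow> subt_at t (\<pi> @ \<tau>) = subt_at (subt_at t \<pi>) \<tau>"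
  by (induction t \<pi> rule: subt_at.induct) auto

text \<open>Serves both directions: with \<open>base\<close> to leave the annotated signature, and
  with the annotating symbol map to enter it.\<close>

lemma map_trm_in_terms:
  assumes "t \<in> terms ar \<Sigma>" and "\<And>f. f \<in> \<Sigma> \<Longrightarrow> h f \<in> \<Sigma>' \<and> ar' (h f) = ar f"
  shows "map_trm h id t \<in> terms ar' \<Sigma>'"
  using assms(1) by induction (auto simp: assms(2) intro!: terms.intros)

section \<open>Erasing annotations\<close>

text \<open>In contrast to \<open>flat\<close>, which stays within annotated terms, this returns to
  the term type of the rewrite system.\<close>

abbreviation erase :: "('f, 'v) atrm \<Rightarrow> ('f, 'v) trm" where
  "erase \<equiv> map_trm base id"

lemma erase_plain [simp]: "erase (plain t) = t"
  by (simp add: plain_def trm.map_comp comp_def trm.map_ident id_def)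

lemma erase_comp_plain_subst [simp]: "erase \<circ> (plain \<circ> \<sigma>) = \<sigma>"
  by (simp add: fun_eq_iff)

lemma erase_annotate [simp]: "erase (annotate \<Phi> t) = erase t"
  by (induction \<Phi> t rule: annotate.induct) (auto intro: nth_equalityI)

lemma erase_flat [simp]: "erase (flat t) = erase t"
  by (simp add: flat_def)

lemma erase_in_terms:
  assumes "t \<in> aterms ar \<Sigma> D" "D \<subseteq> \<Sigma>"
  shows "erase t \<in> terms ar \<Sigma>"
  \<comment> \<open>The inclusion of \<open>D\<close> in the signature is what makes
    \<open>base (Sharp f)\<close> a legal symbol.\<close>
  using assms(1) unfolding aterms_def by (rule map_trm_in_terms) (use assms(2) in auto)

lemma defined_symbols_subset:
  assumes "is_ptrs ar \<Sigma> R"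
  shows "defined_symbols R \<subseteq> \<Sigma>"
  using assms by (fastforce simp: defined_symbols_def is_ptrs_def elim: terms.cases)

section \<open>Relabelling of steps and trees\<close>

lemma successors_map:
  "successors E p (h \<circ> t) v = image_mset (map_prod id h) (successors E p t v)"
  by (simp add: successors_def multiset.map_comp comp_def)

lemma prob_tree_map:
  assumes "prob_tree T V E p t" "\<And>s. s \<in> T \<Longrightarrow> h s \<in> T'"
  shows "prob_tree T' V E p (h \<circ> t)"
  using assms unfolding prob_tree_def by auto

text \<open>Common core of the three kinds of ADP steps. They differ only in the annotations of
  their results, so the results \<open>t j\<close> are fixed here only up to erasure.\<close>

lemma prewrite_erase:
  assumes mem: "(l, mset prs, m) \<in> DP R" and \<sigma>: "is_substitution ar \<Sigma> \<sigma>"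
    and \<pi>: "\<pi> \<in> poss s" and redex: "flat (subt_at s \<pi>) = plain (subst \<sigma> l)"
    and t: "\<And>j. erase (t j) = erase (replace_at s \<pi> (subst (plain \<circ> \<sigma>) (snd (prs ! j))))"
  shows "prewrite ar \<Sigma> R (erase s)
    (image_mset (map_prod id erase) (mset (map (\<lambda>j. (fst (prs ! j), t j)) [0..<length prs])))"
proof -
  \<comment> \<open>A canonical ADP alters its rule by annotations only, so erasing its right-hand
    sides recovers the original distribution.\<close>
  define \<mu> where "\<mu> = image_mset (map_prod id erase) (mset prs)"
  have "(l, \<mu>) \<in> R"
    using mem unfolding DP_def canonical_adp_def \<mu>_def
    by (auto simp: multiset.map_comp comp_def case_prod_unfold)
  moreover have "subt_at (erase s) \<pi> = subst \<sigma> l"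
    using arg_cong[OF redex, of erase] \<pi> by (simp add: subt_at_map_trm)
  moreover have "image_mset (map_prod id erase) (mset (map (\<lambda>j. (fst (prs ! j), t j)) [0..<length prs]))
      = {# (p, replace_at (erase s) \<pi> (subst \<sigma> r)). (p, r) \<in># \<mu> #}"
  proof -
    \<comment> \<open>Listing \<open>prs\<close> by index presents both multisets as images of the
      same index list, which allows an entrywise comparison.\<close>
    have "mset prs = mset (map (\<lambda>j. prs ! j) [0..<length prs])"
      by (simp only: map_nth)
    then show ?thesis
      unfolding \<mu>_def
      by (simp add: t replace_at_map_trm[OF \<pi>] map_trm_subst multiset.map_comp comp_def
          case_prod_unfold del: mset_map flip: mset_map)
  qed
  ultimately show ?thesis
    unfolding prewrite_def using \<sigma> \<pi> by fastforce
qed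

lemma adp_step_erase:
  assumes "adp_step ar \<Sigma> D (DP R) c s \<nu>"
  shows "prewrite ar \<Sigma> R (erase s) (image_mset (map_prod id erase) \<nu>)"
  using assms
proof cases
  case (AT l prs \<phi> \<sigma> \<pi> \<Psi> \<Phi> t)
  show ?thesis unfolding \<open>\<nu> = _\<close>
    by (rule prewrite_erase) (use AT in \<open>auto simp: fun_poss_def replace_at_map_trm\<close>)
next
  \<comment> \<open>Stripping the annotations above \<open>\<pi>\<close> is itself an instance of
    \<open>annotate\<close>, so erasure absorbs it.\<close>
  case (AF l prs \<phi> \<sigma> \<pi> \<Psi> \<Phi> t)
  show ?thesis unfolding \<open>\<nu> = _\<close>
    by (rule prewrite_erase) (use AF in \<open>auto simp: fun_poss_def flat_above_def replace_at_map_trm\<close>)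
next
  case (NT l prs \<phi> \<sigma> \<pi> \<Psi> t)
  show ?thesis unfolding \<open>\<nu> = _\<close>
    by (rule prewrite_erase) (use NT in \<open>auto simp: fun_poss_def replace_at_map_trm\<close>)
qed

lemma is_rst_erase:
  assumes "is_ptrs ar \<Sigma> R" and "is_chain_tree ar \<Sigma> (defined_symbols R) (DP R) V E p t A"
  shows "is_rst ar \<Sigma> R V E p (erase \<circ> t)"
  unfolding is_rst_def
proof (intro conjI ballI)
  show "prob_tree (terms ar \<Sigma>) V E p (erase \<circ> t)"
    using assms erase_in_terms[OF _ defined_symbols_subset[OF assms(1)]]
    unfolding is_chain_tree_def by (blast intro: prob_tree_map)
next
  fix v assume "v \<in> inner_nodes V E"
  then obtain c where "adp_step ar \<Sigma> (defined_symbols R) (DP R) c (t v) (successors E p t v)"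
    using assms(2) unfolding is_chain_tree_def by blast
  then show "prewrite ar \<Sigma> R ((erase \<circ> t) v) (successors E p (erase \<circ> t) v)"
    by (simp add: successors_map adp_step_erase)
qed

section \<open>Annotating all defined symbols\<close>

text \<open>Annotating all defined symbols depends on the symbols alone, not on positions. As a
  symbol map it commutes with subterms and replacement.\<close>

definition sharpen :: "'f set \<Rightarrow> ('f, 'v) trm \<Rightarrow> ('f, 'v) atrm" where
  "sharpen D = map_trm (\<lambda>f. if f \<in> D then Sharp f else Plain f) id"

lemma erase_sharpen [simp]: "erase (sharpen D t) = t"
proof -
  have "base \<circ> (\<lambda>f. if f \<in> D then Sharp f else Plain f) = id"
    by auto
  then show ?thesis
    by (simp add: sharpen_def trm.map_comp trm.map_id)
qed

text \<open>Bridge from annotation by positions to annotation by symbols. Old annotations of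
  \<open>t\<close> and elements of \<open>\<Phi>\<close> outside \<open>t\<close> have no influence.
  With \<open>D\<close> empty it describes \<open>flat\<close>; applied to \<open>plain t\<close> it
  describes the right-hand sides of canonical ADPs.\<close>

lemma annotate_eq_sharpen:
  assumes "\<And>\<pi>. \<pi> \<in> poss t \<Longrightarrow> \<pi> \<in> \<Phi> \<longleftrightarrow> \<pi> \<in> fun_poss D (erase t)"
  shows "annotate \<Phi> t = sharpen D (erase t)"
  using assms
proof (induction \<Phi> t rule: annotate.induct)
  case (1 \<Phi> x)
  then show ?case by (simp add: sharpen_def)
next
  case (2 \<Phi> f ts)
  have "annotate {\<pi>. i # \<pi> \<in> \<Phi>} (ts ! i) = sharpen D (erase (ts ! i))" if "i < length ts" for i
    using that 2(2)[of "i # _"] by (intro 2(1)) (auto simp: fun_poss_def)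
  moreover have "[] \<in> \<Phi> \<longleftrightarrow> base f \<in> D"
    using 2(2)[of "[]"] by (auto simp: fun_poss_def)
  ultimately show ?case
    by (auto simp: sharpen_def id_def intro!: nth_equalityI)
qed

lemma flat_eq_plain_erase: "flat t = plain (erase t)"
  using annotate_eq_sharpen[of t "{}" "{}"]
  by (simp add: flat_def fun_poss_def sharpen_def plain_def)

lemma annotate_canonical: "annotate (fun_poss D t) (plain t) = sharpen D t"
  using annotate_eq_sharpen[of "plain t" "fun_poss D t" D] by simp

lemma poss_sharpen [simp]: "poss (sharpen D t) = poss t"
  by (simp add: sharpen_def)

lemma subt_at_sharpen:
  "\<pi> \<in> poss t \<Longrightarrow> subt_at (sharpen D t) \<pi> = sharpen D (subt_at t \<pi>)"
  by (simp add: sharpen_def subt_at_map_trm)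

lemma plain_Var: "plain (Var x) = Var x"
  by (simp add: plain_def)

lemma sharpen_Var: "sharpen D (Var x) = Var x"
  by (simp add: sharpen_def)

lemma sharpen_eq_Var_iff: "sharpen D t = Var x \<longleftrightarrow> t = Var x"
  by (cases t) (simp_all add: sharpen_def)

lemma var_poss_sharpen [simp]: "var_poss (sharpen D t) = var_poss t"
  by (auto simp: var_poss_def subt_at_sharpen sharpen_eq_Var_iff)

lemma fun_poss_sharpen [simp]: "fun_poss (Sharp ` D) (sharpen D t) = fun_poss D t"
proof -
  have "(\<exists>f ts. f \<in> Sharp ` D \<and> sharpen D u = Fun f ts) \<longleftrightarrow> (\<exists>f ts. f \<in> D \<and> u = Fun f ts)" for u :: "('a, 'b) trm"
    by (cases u) (auto simp: sharpen_def)
  then show ?thesis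
    by (simp add: fun_poss_def subt_at_sharpen cong: conj_cong)
qed

lemma sharpen_in_aterms:
  assumes "t \<in> terms ar \<Sigma>"
  shows "sharpen D t \<in> aterms ar \<Sigma> D"
  using assms unfolding aterms_def sharpen_def by (auto intro!: map_trm_in_terms)

section \<open>Annotation positions in instances of a term\<close>

lemma fun_poss_append:
  "\<rho> @ \<tau> \<in> fun_poss D t \<longleftrightarrow> \<rho> \<in> poss t \<and> \<tau> \<in> fun_poss D (subt_at t \<rho>)"
  by (auto simp: fun_poss_def poss_append subt_at_append)

lemma fun_poss_subst_below:
  assumes "\<rho> \<in> poss t" "subt_at t \<rho> = Var x"
  shows "\<rho> @ \<tau> \<in> fun_poss D (subst \<sigma> t) \<longleftrightarrow> \<tau> \<in> fun_poss D (\<sigma> x)"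
  using assms by (simp add: fun_poss_append poss_substI subt_at_subst)

text \<open>A non-variable position keeps its symbol under \<open>\<sigma>\<close>; every other
  position lies in some \<open>\<sigma> x\<close>. The split \<open>\<rho> @ \<tau>\<close> has the
  shape in which \<open>moved_annotations\<close> builds its positions.\<close>

lemma fun_poss_subst:
  "\<pi> \<in> fun_poss D (subst \<sigma> t) \<longleftrightarrow> \<pi> \<in> fun_poss D t \<or>
     (\<exists>\<rho> \<tau> x. \<pi> = \<rho> @ \<tau> \<and> \<rho> \<in> poss t \<and> subt_at t \<rho> = Var x \<and> \<tau> \<in> fun_poss D (\<sigma> x))"
  (is "?L \<longleftrightarrow> ?A \<or> ?B")
proof
  assume L: ?L
  then consider (inside) "\<pi> \<in> poss t" "\<pi> \<notin> var_poss t"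
    | (below) \<rho> \<tau> x where "\<pi> = \<rho> @ \<tau>" "\<rho> \<in> poss t" "subt_at t \<rho> = Var x"
    by (auto simp: fun_poss_def var_poss_def prefix_def dest!: poss_subst_cases)
  then show "?A \<or> ?B"
  proof cases
    case inside
    then show ?thesis
      using L by (cases "subt_at t \<pi>") (auto simp: fun_poss_def var_poss_def subt_at_subst)
  next
    case below
    with L fun_poss_subst_below[of \<rho> t x \<tau> D \<sigma>] show ?thesis
      by blast
  qed
next
  assume "?A \<or> ?B"
  then show ?L
  proof
    assume ?A
    then show ?L by (auto simp: fun_poss_def poss_substI subt_at_subst)
  next
    assume ?B
    then show ?L by (auto simp: fun_poss_subst_below)
  qed
qed

text \<open>The counting assumption gives, for each variable, an injection from its occurrences in
  \<open>r\<close> into those in \<open>l\<close>. Its inverse reaches every variable position of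
  \<open>r\<close>.\<close>

lemma covering_reposition:
  fixes l r :: "('f, 'v) trm"
  assumes "\<And>x. occurrences x r \<le> occurrences x l"
  obtains \<phi> :: "pos \<Rightarrow> pos option" where
    "\<And>\<rho> \<rho>'. \<phi> \<rho> = Some \<rho>' \<Longrightarrow> \<rho>' \<in> var_poss r \<and> subt_at l \<rho> = subt_at r \<rho>'"
    "\<And>\<rho>'. \<rho>' \<in> var_poss r \<Longrightarrow> \<exists>\<rho> \<in> var_poss l. \<phi> \<rho> = Some \<rho>'"
proof -
  define B where "B t x = {\<pi> \<in> poss t. subt_at t \<pi> = Var x}" for t :: "('f, 'v) trm" and x
  have "finite (B t x)" for t x
    by (simp add: B_def)
  then have "\<exists>g. g ` B r x \<subseteq> B l x \<and> inj_on g (B r x)" for x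
    using assms[of x] by (intro card_le_inj) (auto simp: B_def occurrences_def)
  then obtain g where g: "\<And>x. g x ` B r x \<subseteq> B l x" "\<And>x. inj_on (g x) (B r x)"
    by metis
  \<comment> \<open>The variable at \<open>\<rho>\<close> selects the injection to invert. Positions
    outside its image are mapped to \<open>None\<close>, so their annotations are dropped.\<close>
  define \<phi> where "\<phi> \<rho> = (case subt_at l \<rho> of
      Var x \<Rightarrow> if \<rho> \<in> g x ` B r x then Some (inv_into (B r x) (g x) \<rho>) else None
    | Fun f ts \<Rightarrow> None)" for \<rho>
  show thesis
  proof
    fix \<rho> \<rho>' assume "\<phi> \<rho> = Some \<rho>'"
    then obtain x where x: "subt_at l \<rho> = Var x" "\<rho> \<in> g x ` B r x" "\<rho>' = inv_into (B r x) (g x) \<rho>"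
      by (auto simp: \<phi>_def split: trm.splits if_splits)
    then have "\<rho>' \<in> B r x"
      by (simp add: inv_into_into)
    with x show "\<rho>' \<in> var_poss r \<and> subt_at l \<rho> = subt_at r \<rho>'"
      by (auto simp: B_def var_poss_def)
  next
    fix \<rho>' assume "\<rho>' \<in> var_poss r"
    then obtain x where x: "\<rho>' \<in> B r x"
      by (auto simp: B_def var_poss_def)
    then have "g x \<rho>' \<in> B l x"
      using g by blast
    \<comment> \<open>Membership in \<open>B l x\<close> selects the branch for \<open>x\<close>,
      and injectivity makes the inverse return exactly \<open>\<rho>'\<close>.\<close>
    moreover from this have "\<phi> (g x \<rho>') = Some \<rho>'"
      using x g(2)[of x] by (auto simp: \<phi>_def B_def)
    ultimately show "\<exists>\<rho> \<in> var_poss l. \<phi> \<rho> = Some \<rho>'"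
      by (auto simp: B_def var_poss_def)
  qed
qed

text \<open>By \<open>cover\<close>, each variable position of \<open>r\<close> has a source in
  \<open>l\<close>; by \<open>sound\<close>, both carry the same variable and hence the same
  instance. As the redex is fully annotated, all defined symbols inside that instance arrive
  annotated.\<close>

lemma fun_poss_subst_moved_annotations:
  assumes sound: "\<And>\<rho> \<rho>'. \<phi> \<rho> = Some \<rho>' \<Longrightarrow> \<rho>' \<in> var_poss r \<and> subt_at l \<rho> = subt_at r \<rho>'"
    and cover: "\<And>\<rho>'. \<rho>' \<in> var_poss r \<Longrightarrow> \<exists>\<rho> \<in> var_poss l. \<phi> \<rho> = Some \<rho>'"
  shows "fun_poss D (subst \<sigma> r) =
    fun_poss D r \<union> moved_annotations D l \<phi> (sharpen D (subst \<sigma> l))"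
proof -
  show ?thesis
  proof (intro set_eqI iffI)
    fix \<pi> assume "\<pi> \<in> fun_poss D (subst \<sigma> r)"
    then consider "\<pi> \<in> fun_poss D r" | \<rho>' \<tau> x where "\<pi> = \<rho>' @ \<tau>" "\<rho>' \<in> poss r"
        "subt_at r \<rho>' = Var x" "\<tau> \<in> fun_poss D (\<sigma> x)"
      by (auto simp: fun_poss_subst)
    then show "\<pi> \<in> fun_poss D r \<union> moved_annotations D l \<phi> (sharpen D (subst \<sigma> l))"
    proof cases
      case 2
      then obtain \<rho> where "\<rho> \<in> var_poss l" "\<phi> \<rho> = Some \<rho>'"
        using cover[of \<rho>'] by (auto simp: var_poss_def)
      moreover from this have "\<rho> @ \<tau> \<in> fun_poss D (subst \<sigma> l)"
        using 2 sound[of \<rho> \<rho>'] fun_poss_subst_below[of \<rho> l x \<tau> D \<sigma>] by (auto simp: var_poss_def)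
      ultimately show ?thesis
        using 2 by (auto simp: moved_annotations_def)
    qed simp
  next
    fix \<pi> assume "\<pi> \<in> fun_poss D r \<union> moved_annotations D l \<phi> (sharpen D (subst \<sigma> l))"
    then consider "\<pi> \<in> fun_poss D r" | \<rho> \<rho>' \<tau> where "\<pi> = \<rho>' @ \<tau>" "\<rho> \<in> var_poss l"
        "\<phi> \<rho> = Some \<rho>'" "\<rho> @ \<tau> \<in> fun_poss D (subst \<sigma> l)"
      by (auto simp: moved_annotations_def)
    then show "\<pi> \<in> fun_poss D (subst \<sigma> r)"
    proof cases
      case 2
      then obtain x where "\<rho> \<in> poss l" "subt_at l \<rho> = Var x"
        by (auto simp: var_poss_def)
      with 2 sound[of \<rho> \<rho>'] fun_poss_subst_below[of \<rho> l x \<tau> D \<sigma>] show ?thesis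
        by (auto simp: fun_poss_subst var_poss_def)
    qed (simp add: fun_poss_subst)
  qed
qed

text \<open>Full annotation is an invariant: the redex root is annotated, which enables case
  \<open>AT\<close>, and a covering VRF makes the result fully annotated again.\<close>

lemma adp_step_sharpen:
  assumes ptrs: "is_ptrs ar \<Sigma> R" and nd: "non_duplicating R" and step: "prewrite ar \<Sigma> R s \<nu>"
  defines "D \<equiv> defined_symbols R"
  shows "adp_step ar \<Sigma> D (DP R) AT (sharpen D s) (image_mset (map_prod id (sharpen D)) \<nu>)"
proof -
  from step obtain l \<mu> \<sigma> \<pi> where l: "(l, \<mu>) \<in> R" and \<sigma>: "is_substitution ar \<Sigma> \<sigma>"
    and \<pi>: "\<pi> \<in> poss s" and redex: "subt_at s \<pi> = subst \<sigma> l"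
    and \<nu>: "\<nu> = {# (p, replace_at s \<pi> (subst \<sigma> r)). (p, r) \<in># \<mu> #}"
    unfolding prewrite_def by blast
  obtain f ts where f: "l = Fun f ts"
    using ptrs l unfolding is_ptrs_def by (cases l) auto
  then have "f \<in> D"
    using l by (auto simp: D_def defined_symbols_def)
  obtain xs where xs: "\<mu> = mset xs"
    by (metis ex_mset)
  define prs where "prs = map (map_prod id (sharpen D)) xs"
  have adp: "(l, mset prs, True) \<in> DP R"
  proof -
    have "mset prs = {# (p, annotate (fun_poss D r) (plain r)). (p, r) \<in># \<mu> #}"
      unfolding prs_def xs
      by (simp add: annotate_canonical map_prod_def flip: mset_map)
    then show ?thesis
      using l unfolding DP_def canonical_adp_def D_def by force
  qed
  \<comment> \<open>The guard on \<open>j\<close> lets one function be chosen for all indices, with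
    an arbitrary value beyond the list.\<close>
  have "\<forall>j. \<exists>\<phi>. j < length xs \<longrightarrow> (\<forall>\<rho> \<rho>'. \<phi> \<rho> = Some \<rho>' \<longrightarrow>
        \<rho>' \<in> var_poss (snd (xs ! j)) \<and> subt_at l \<rho> = subt_at (snd (xs ! j)) \<rho>') \<and>
      (\<forall>\<rho>' \<in> var_poss (snd (xs ! j)). \<exists>\<rho> \<in> var_poss l. \<phi> \<rho> = Some \<rho>')"
    (is "\<forall>j. \<exists>\<phi>. j < length xs \<longrightarrow> ?C j \<phi>")
  proof
    fix j
    show "\<exists>\<phi>. j < length xs \<longrightarrow> ?C j \<phi>"
    proof (cases "j < length xs")
      case True
      then have "snd (xs ! j) \<in># supp \<mu>"
        by (auto simp: supp_def xs)
      then have "occurrences x (snd (xs ! j)) \<le> occurrences x l" for x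
        using nd l by (auto simp: non_duplicating_def)
      then obtain \<phi> where "\<And>\<rho> \<rho>'. \<phi> \<rho> = Some \<rho>' \<Longrightarrow>
          \<rho>' \<in> var_poss (snd (xs ! j)) \<and> subt_at l \<rho> = subt_at (snd (xs ! j)) \<rho>'"
        and "\<And>\<rho>'. \<rho>' \<in> var_poss (snd (xs ! j)) \<Longrightarrow> \<exists>\<rho> \<in> var_poss l. \<phi> \<rho> = Some \<rho>'"
        using covering_reposition[of "snd (xs ! j)" l] by metis
      then have "?C j \<phi>"
        by blast
      then show ?thesis
        by blast
    qed simp
  qed
  from choice[OF this]
  obtain \<phi> where sound: "\<And>j \<rho> \<rho>'. j < length xs \<Longrightarrow> \<phi> j \<rho> = Some \<rho>' \<Longrightarrow>
        \<rho>' \<in> var_poss (snd (xs ! j)) \<and> subt_at l \<rho> = subt_at (snd (xs ! j)) \<rho>'"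
    and cover: "\<And>j \<rho>'. j < length xs \<Longrightarrow> \<rho>' \<in> var_poss (snd (xs ! j)) \<Longrightarrow>
        \<exists>\<rho> \<in> var_poss l. \<phi> j \<rho> = Some \<rho>'"
    by blast
  have vrf: "is_vrf l prs \<phi>"
    unfolding is_vrf_def
  proof (intro allI ballI impI)
    fix j \<rho> \<rho>' assume "j < length prs" "\<rho> \<in> var_poss l" "\<phi> j \<rho> = Some \<rho>'"
    with sound[of j \<rho> \<rho>']
    show "\<rho>' \<in> var_poss (snd (prs ! j)) \<and> plain (subt_at l \<rho>) = subt_at (snd (prs ! j)) \<rho>'"
      by (auto simp: prs_def subt_at_sharpen var_poss_def sharpen_Var plain_Var)
  qed
  \<comment> \<open>The root of a left-hand side is a defined symbol, so the redex root carries an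
    annotation.\<close>
  have root: "\<pi> \<in> fun_poss (Sharp ` D) (sharpen D s)"
    unfolding fun_poss_sharpen using \<pi> redex f \<open>f \<in> D\<close> by (auto simp: fun_poss_def)
  have u: "subt_at (sharpen D s) \<pi> = sharpen D (subst \<sigma> l)"
    using \<pi> redex by (simp add: subt_at_sharpen)
  define \<Psi> where "\<Psi> j = moved_annotations D l (\<phi> j) (subt_at (sharpen D s) \<pi>)" for j
  define \<Phi> where "\<Phi> j = fun_poss (Sharp ` D) (snd (prs ! j)) \<union> \<Psi> j" for j
  define t where "t j = replace_at (sharpen D s) \<pi> (annotate (\<Phi> j) (subst (plain \<circ> \<sigma>) (snd (prs ! j))))" for j
  have "adp_step ar \<Sigma> D (DP R) AT (sharpen D s) (mset (map (\<lambda>j. (fst (prs ! j), t j)) [0..<length prs]))"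
  proof (rule adp_step.AT[where \<Psi> = \<Psi> and \<Phi> = \<Phi> and t = t, OF adp vrf \<sigma> _ _ root])
    show "\<pi> \<in> fun_poss (Plain ` D \<union> Sharp ` D) (sharpen D s)"
      using root unfolding fun_poss_def by blast
    show "flat (subt_at (sharpen D s) \<pi>) = plain (subst \<sigma> l)"
      by (simp add: u flat_eq_plain_erase)
  qed (simp_all add: \<Psi>_def \<Phi>_def t_def)
  moreover have "t j = sharpen D (replace_at s \<pi> (subst \<sigma> (snd (xs ! j))))" if "j < length xs" for j
  proof -
    have "fun_poss D (subst \<sigma> (snd (xs ! j))) =
        fun_poss D (snd (xs ! j)) \<union> moved_annotations D l (\<phi> j) (sharpen D (subst \<sigma> l))"
      using sound[OF that] cover[OF that] by (rule fun_poss_subst_moved_annotations)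
    then have "\<Phi> j = fun_poss D (subst \<sigma> (snd (xs ! j)))"
      using that by (simp add: \<Phi>_def \<Psi>_def u prs_def)
    \<comment> \<open>The right-hand side in \<open>prs\<close> is already annotated while
      \<open>plain \<circ> \<sigma>\<close> is not; \<open>annotate\<close> overwrites both, so only
      the erased term matters.\<close>
    then have "annotate (\<Phi> j) (subst (plain \<circ> \<sigma>) (snd (prs ! j))) = sharpen D (subst \<sigma> (snd (xs ! j)))"
      using annotate_eq_sharpen[of "subst (plain \<circ> \<sigma>) (snd (prs ! j))" "\<Phi> j" D] that
      by (simp add: map_trm_subst prs_def)
    then show ?thesis
      by (simp add: t_def sharpen_def replace_at_map_trm[OF \<pi>])
  qed
  then have "map (\<lambda>j. (fst (prs ! j), t j)) [0..<length prs] =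
      map (\<lambda>(p, r). (p, sharpen D (replace_at s \<pi> (subst \<sigma> r)))) xs"
    by (intro nth_equalityI) (auto simp: prs_def case_prod_unfold)
  then have "mset (map (\<lambda>j. (fst (prs ! j), t j)) [0..<length prs]) = image_mset (map_prod id (sharpen D)) \<nu>"
    by (simp add: \<nu> xs multiset.map_comp comp_def case_prod_unfold)
  ultimately show ?thesis
    by simp
qed

section \<open>Infinite paths in directed trees\<close>

text \<open>As parents are unique, a cycle through a node passes through its parent. Descending from
  the root, which has no incoming edge, no node can therefore lie on a cycle.\<close>

lemma directed_tree_acyclic:
  assumes "directed_tree V E v\<^sub>0"
  shows "acyclic E"
  unfolding acyclic_def
proof (intro allI notI)
  fix v assume cycle: "(v, v) \<in> E\<^sup>+"
  then have "v \<in> V"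
    using assms unfolding directed_tree_def by (meson mem_Sigma_iff subsetD tranclD)
  then have "(v\<^sub>0, v) \<in> E\<^sup>*"
    using assms unfolding directed_tree_def by blast
  then have "(v, v) \<notin> E\<^sup>+"
  proof induction
    case base
    then show ?case
      using assms unfolding directed_tree_def by (meson tranclD2)
  next
    case (step u v)
    show ?case
    proof
      assume "(v, v) \<in> E\<^sup>+"
      then obtain u' where "(v, u') \<in> E\<^sup>*" "(u', v) \<in> E"
        by (meson tranclD2)
      moreover from this have "u' = u"
        \<comment> \<open>The last edge of the cycle starts in the parent \<open>u\<close>, so
          rotating the cycle gives one through \<open>u\<close>, against the induction
          hypothesis.\<close>
        using assms step(2) unfolding directed_tree_def by blast
      ultimately show False
        using step by (meson rtrancl_into_trancl2)
    qed
  qed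
  with cycle show False by contradiction
qed

text \<open>A repeated node would close a cycle, so the path is injective.\<close>

lemma infinite_range_path:
  fixes path :: "nat \<Rightarrow> 'n"
  assumes "acyclic E" and "\<And>i. (path i, path (Suc i)) \<in> E"
  shows "infinite (range path)"
proof (rule range_inj_infinite, rule linorder_injI)
  fix i j :: nat assume "i < j"
  then have "(path i, path j) \<in> E\<^sup>+"
    by (induction rule: less_Suc_induct) (use assms(2) in \<open>auto intro: trancl_trans\<close>)
  then show "path i \<noteq> path j"
    using assms(1) by (auto simp: acyclic_def)
qed

lemma is_chain_tree_sharpen:
  assumes "is_ptrs ar \<Sigma> R" and "non_duplicating R" and rst: "is_rst ar \<Sigma> R V E p t"
  defines "D \<equiv> defined_symbols R"
  shows "is_chain_tree ar \<Sigma> D (DP R) V E p (sharpen D \<circ> t) (inner_nodes V E)"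
  unfolding is_chain_tree_def
proof (intro conjI ballI allI impI)
  show "prob_tree (aterms ar \<Sigma> D) V E p (sharpen D \<circ> t)"
    using rst sharpen_in_aterms unfolding is_rst_def by (blast intro: prob_tree_map)
next
  fix v assume v: "v \<in> inner_nodes V E"
  then have "adp_step ar \<Sigma> D (DP R) AT ((sharpen D \<circ> t) v) (successors E p (sharpen D \<circ> t) v)"
    using adp_step_sharpen[OF assms(1,2)] rst unfolding is_rst_def D_def by (simp add: successors_map)
  with v show "\<exists>c. c \<in> (if v \<in> inner_nodes V E then {AT, AF} else {NT}) \<and>
      adp_step ar \<Sigma> D (DP R) c ((sharpen D \<circ> t) v) (successors E p (sharpen D \<circ> t) v)"
    by auto
next
  fix path :: "nat \<Rightarrow> 'c" assume path: "\<forall>i. (path i, path (Suc i)) \<in> E"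
  obtain v\<^sub>0 where tree: "directed_tree V E v\<^sub>0"
    using rst unfolding is_rst_def prob_tree_def by blast
  \<comment> \<open>Each node on an infinite path has an outgoing edge, so the intersection with the
    inner nodes is the whole path.\<close>
  have inner: "range path \<subseteq> inner_nodes V E"
    using path tree unfolding inner_nodes_def directed_tree_def by blast
  show "infinite (range path \<inter> inner_nodes V E)"
    using infinite_range_path[OF directed_tree_acyclic[OF tree]] path inner
    by (simp add: Int_absorb2)
qed simp

theorem theorem13:
  fixes ar :: "'f \<Rightarrow> nat" and \<Sigma> :: "'f set" and R :: "('f, 'v) prule set"
  assumes "finite \<Sigma>"
    and "is_ptrs ar \<Sigma> R"
    and "non_duplicating R"
  shows "ptrs_AST ar \<Sigma> R \<longleftrightarrow> adp_AST ar \<Sigma> (defined_symbols R) (DP R)"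
  \<comment> \<open>The first fact turns chain trees into rewrite sequence trees and gives the
    left-to-right direction, the second gives the converse. Since \<open>V\<close>, \<open>E\<close>
    and \<open>p\<close> stay fixed, so does the leaf weight.\<close>
  using is_rst_erase[OF assms(2)] is_chain_tree_sharpen[OF assms(2,3)]
  unfolding ptrs_AST_def adp_AST_def by blast

end
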